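(* Let $G=(V,w,\mu)$ be a connected finite weighted graph with symmetric edge weights $w$ and vertex measure $\mu\in\mathcal{M}^*(V)$, and let $\deg$ denote its vertex degree. Let $B\subset V$ with $|B|\ge 2$ and $\mu_B=1_B\,\mu\in\mathcal{M}(V)$. Then $$2\,h(\mu_B,\mu_B)\ \ge\ \sigma_2\ \ge\ \frac12\, h(\mu_B,\mu_B)\, h(\deg,\mu_B),$$ where $\sigma_2$ is the second smallest eigenvalue (counted with multiplicity) of the Steklov operator $T=T^B$.
   Context: $V$ is a finite set with $|V|\ge 2$. $\mathcal{M}(V)=\{\nu:V\to[0,\infty)\}$ and $\mathcal{M}^*(V)=\{\nu:V\to(0,\infty)\}$; $\nu(A)=\sum_{x\in A}\nu(x)$ for $A\subset V$. $1_B$ is the characteristic function of $B$. A finite weighted graph $G=(V,w,\mu)$ consists of symmetric edge weights $w:V\times V\to[0,\infty)$, $w(x,y)=w(y,x)$, $w(x,x)=0$, and $\mu\in\mathcal{M}^*(V)$; $x,y$ are joined by an edge iff $w(x,y)>0$, and $G$ is connected if this graph is connected. Put $A^c=V\setminus A$, $w(A,A')=\sum_{x\in A,\,y\in A'}w(x,y)$, and $\deg(x)=\sum_{y\ne x}w(x,y)$. The Laplacian is $\Delta f(x)=\frac1{\mu(x)}\sum_{y\in V}w(x,y)(f(x)-f(y))$. Generalized Cheeger constant: for $\mu',\nu\in\mathcal{M}(V)$, $$h(\mu',\nu)=\inf_{\substack{A\subset V:\ \mu'(A)>0,\\ \nu(A)\le\nu(V)/2}}\frac{w(A,A^c)}{\mu'(A)}$$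 (always with the same edge weights $w$). Steklov operator: every $f:B\to\mathbb{C}$ has a unique harmonic extension $F:V\to\mathbb{C}$, i.e. $F=f$ on $B$ and $\Delta F=0$ on $B^c$. The Steklov operator $T=T^B$ acts on functions $B\to\mathbb{C}$ by $Tf(x)=\Delta F(x)$ for $x\in B$. Its eigenvalues are real and non-negative, $0=\sigma_1\le\sigma_2\le\cdots\le\sigma_{|B|}$, counted with multiplicity. *)

theory Defs
  imports "HOL-Analysis.Analysis" "HOL-Library.Multiset"
begin

text \<open>The vertex set \<open>V\<close> is the universe of a finite type.\<close>

locale weighted_graph =
  fixes w :: "'v::finite \<Rightarrow> 'v \<Rightarrow> real" and \<mu> :: "'v \<Rightarrow> real"
  assumes card_vertices: "CARD('v) \<ge> 2"
    and weight_nonneg: "w x y \<ge> 0"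
    and weight_sym: "w x y = w y x"
    and weight_loop: "w x x = 0"
    and measure_pos: "\<mu> x > 0"

definition graph_connected :: "('v \<Rightarrow> 'v \<Rightarrow> real) \<Rightarrow> bool" where
  "graph_connected w \<longleftrightarrow> (\<forall>x y. (x, y) \<in> {(u, v). w u v > 0}\<^sup>*)"

definition cut_weight :: "('v \<Rightarrow> 'v \<Rightarrow> real) \<Rightarrow> 'v set \<Rightarrow> 'v set \<Rightarrow> real" where
  "cut_weight w A A' = (\<Sum>x\<in>A. \<Sum>y\<in>A'. w x y)"

definition vertex_degree :: "('v::finite \<Rightarrow> 'v \<Rightarrow> real) \<Rightarrow> 'v \<Rightarrow> real" where
  "vertex_degree w x = (\<Sum>y\<in>UNIV - {x}. w x y)"

definition restrict_measure :: "'v set \<Rightarrow> ('v \<Rightarrow> real) \<Rightarrow> 'v \<Rightarrow> real" where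
  "restrict_measure B \<mu> x = indicator B x * \<mu> x"

text \<open>The infimum is taken in the reals, so the value is meaningful only if some set \<open>A\<close> is
  admissible. This is the case for \<open>h(\<mu>\<^sub>B, \<mu>\<^sub>B)\<close> and \<open>h(deg, \<mu>\<^sub>B)\<close> on a connected graph when
  \<open>B\<close> has at least two vertices: take for \<open>A\<close> a single vertex of \<open>B\<close> of least measure.\<close>

definition cheeger ::
  "('v::finite \<Rightarrow> 'v \<Rightarrow> real) \<Rightarrow> ('v \<Rightarrow> real) \<Rightarrow> ('v \<Rightarrow> real) \<Rightarrow> real" where
  "cheeger w \<mu>' \<nu> =
     Inf {cut_weight w A (- A) / sum \<mu>' A | A. sum \<mu>' A > 0 \<and> sum \<nu> A \<le> sum \<nu> UNIV / 2}"

definition laplacian ::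
  "('v::finite \<Rightarrow> 'v \<Rightarrow> real) \<Rightarrow> ('v \<Rightarrow> real) \<Rightarrow> complex ^ 'v \<Rightarrow> complex ^ 'v" where
  "laplacian w \<mu> F =
     (\<chi> x. 1 / complex_of_real (\<mu> x) * (\<Sum>y\<in>UNIV. complex_of_real (w x y) * (F $ x - F $ y)))"

text \<open>A function \<open>B \<rightarrow> \<complex>\<close> is represented by the vector of its values on \<open>B\<close>, extended by zero to
  all of \<open>V\<close>. (This zero extension only fixes a representative; it is unrelated to the
  harmonic extension.)\<close>

definition functions_on :: "'v set \<Rightarrow> (complex ^ 'v::finite) set" where
  "functions_on B = {f. \<forall>x. x \<notin> B \<longrightarrow> f $ x = 0}"

definition harmonic_extension ::
  "('v::finite \<Rightarrow> 'v \<Rightarrow> real) \<Rightarrow> ('v \<Rightarrow> real) \<Rightarrow> 'v set \<Rightarrow> complex ^ 'v \<Rightarrow> complex ^ 'v" where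
  "harmonic_extension w \<mu> B f =
     (THE F. (\<forall>x\<in>B. F $ x = f $ x) \<and> (\<forall>x\<in>- B. laplacian w \<mu> F $ x = 0))"

definition steklov ::
  "('v::finite \<Rightarrow> 'v \<Rightarrow> real) \<Rightarrow> ('v \<Rightarrow> real) \<Rightarrow> 'v set \<Rightarrow> complex ^ 'v \<Rightarrow> complex ^ 'v" where
  "steklov w \<mu> B f =
     (\<chi> x. if x \<in> B then laplacian w \<mu> (harmonic_extension w \<mu> B f) $ x else 0)"

definition steklov_eigenspace ::
  "('v::finite \<Rightarrow> 'v \<Rightarrow> real) \<Rightarrow> ('v \<Rightarrow> real) \<Rightarrow> 'v set \<Rightarrow> complex \<Rightarrow> (complex ^ 'v) set" where
  "steklov_eigenspace w \<mu> B z = {f \<in> functions_on B. steklov w \<mu> B f = z *s f}"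

definition steklov_eigenvalues ::
  "('v::finite \<Rightarrow> 'v \<Rightarrow> real) \<Rightarrow> ('v \<Rightarrow> real) \<Rightarrow> 'v set \<Rightarrow> complex set" where
  "steklov_eigenvalues w \<mu> B = {z. \<exists>f \<in> steklov_eigenspace w \<mu> B z. f \<noteq> 0}"

text \<open>The multiplicity of an eigenvalue is the complex dimension of its eigenspace. Since the
  Steklov operator is self-adjoint for the inner product weighted by \<open>\<mu>\<close> on \<open>B\<close>, this is also
  the algebraic multiplicity, all eigenvalues are real (so taking real parts below loses
  nothing), and there are \<open>card B\<close> of them.\<close>

definition steklov_spectrum ::
  "('v::finite \<Rightarrow> 'v \<Rightarrow> real) \<Rightarrow> ('v \<Rightarrow> real) \<Rightarrow> 'v set \<Rightarrow> complex multiset" where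
  "steklov_spectrum w \<mu> B =
     (\<Sum>z\<in>steklov_eigenvalues w \<mu> B. replicate_mset (vec.dim (steklov_eigenspace w \<mu> B z)) z)"

text \<open>The numbering of \<open>\<sigma>\<^sub>1 \<le> \<sigma>\<^sub>2 \<le> \<dots>\<close> starts at 1, that of list entries at 0.\<close>

definition steklov_sigma ::
  "('v::finite \<Rightarrow> 'v \<Rightarrow> real) \<Rightarrow> ('v \<Rightarrow> real) \<Rightarrow> 'v set \<Rightarrow> nat \<Rightarrow> real" where
  "steklov_sigma w \<mu> B k =
     sorted_list_of_multiset (image_mset Re (steklov_spectrum w \<mu> B)) ! (k - 1)"

end

theory Submission
  imports Defs
begin

text \<open>A real function \<open>F\<close> on all vertices is called a mode with eigenvalue \<open>\<sigma>\<close> if its unnormalised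
  Laplacian equals \<open>\<sigma> \<mu>\<^sub>B F\<close>: it is harmonic off \<open>B\<close>, and on \<open>B\<close> its Laplacian is \<open>\<sigma> F\<close>. So modes are
  the harmonic extensions of Steklov eigenfunctions, and the spectral problem becomes a symmetric
  one for two quadratic forms on functions \<open>V \<rightarrow> \<real>\<close>, the energy \<open>E\<close> and the boundary
  product \<open>M F = \<Sum>\<^bsub>x\<in>B\<^esub> \<mu> x (F x)\<^sup>2\<close>.

  On a connected graph the eigenvalue \<open>0\<close> belongs to the constants only and so is simple. Every
  other eigenvalue is positive. There are finitely many of them, because modes of distinct
  eigenvalues are orthogonal on \<open>B\<close>. Minimising \<open>E / M\<close> over the functions that are balanced,
  i.e. orthogonal to the constants on \<open>B\<close>, shows that there is at least one, and that one of them
  bounds this quotient from below (\<open>rayleigh_minimizer\<close>). Hence \<open>\<sigma>\<^sub>2\<close> is the least positive eigenvalue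
  (\<open>steklov_sigma_2_eq\<close>), and \<open>\<sigma>\<^sub>2 M F \<le> E F\<close> for every balanced \<open>F\<close>.

  The upper bound tests this inequality with the indicator of an admissible set \<open>A\<close> minus its mean:
  the energy is the cut weight of \<open>A\<close>, and \<open>M\<close> is at least half of \<open>\<mu>\<^sub>B A\<close>.

  For the lower bound take a mode \<open>F\<close> for \<open>\<sigma>\<^sub>2\<close>, with its sign chosen such that \<open>{F > 0}\<close> carries at
  most half of \<open>\<mu>\<^sub>B\<close>, and its positive part \<open>g\<close>. Truncation gives \<open>E g \<le> \<sigma>\<^sub>2 M g\<close>. The superlevel
  sets of \<open>g\<^sup>2\<close> are all admissible for both Cheeger constants \<open>h\<close> and \<open>h'\<close> of the theorem, so the total
  variation \<open>C\<close> of \<open>g\<^sup>2\<close> is at least \<open>h M g\<close> and at least \<open>h' D\<close> with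
  \<open>D = \<Sum>\<^bsub>x\<in>V\<^esub> deg x (g x)\<^sup>2\<close> (\<open>layer_cake_bound\<close>). Cauchy-Schwarz gives \<open>C\<^sup>2 \<le> 2 E g D\<close>
  (\<open>total_variation_square_bound\<close>). Multiplying the two lower bounds for \<open>C\<close> and cancelling \<open>D\<close> and
  \<open>M g\<close> leaves \<open>h h' \<le> 2 \<sigma>\<^sub>2\<close>. The use of two different measures costs nothing because the
  factor \<open>D\<close> that Cauchy-Schwarz produces is the one that \<open>h'\<close> controls.\<close>

section \<open>Energy, total variation and cuts\<close>

text \<open>The Laplacian multiplied by \<open>\<mu>\<close>. Without the factor \<open>1 / \<mu>\<close> it is symmetric for the
  unweighted sum over the vertices.\<close>
definition outflow :: "('v::finite \<Rightarrow> 'v \<Rightarrow> real) \<Rightarrow> ('v \<Rightarrow> real) \<Rightarrow> 'v \<Rightarrow> real" where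
  "outflow w F x = (\<Sum>y\<in>UNIV. w x y * (F x - F y))"

text \<open>The sum counts each edge twice, hence the factor \<open>1 / 2\<close>; the same holds for the total variation
  below.\<close>
definition energy :: "('v::finite \<Rightarrow> 'v \<Rightarrow> real) \<Rightarrow> ('v \<Rightarrow> real) \<Rightarrow> ('v \<Rightarrow> real) \<Rightarrow> real" where
  "energy w F G = (\<Sum>x\<in>UNIV. \<Sum>y\<in>UNIV. w x y * (F x - F y) * (G x - G y)) / 2"

definition total_variation :: "('v::finite \<Rightarrow> 'v \<Rightarrow> real) \<Rightarrow> ('v \<Rightarrow> real) \<Rightarrow> real" where
  "total_variation w F = (\<Sum>x\<in>UNIV. \<Sum>y\<in>UNIV. w x y * \<bar>F x - F y\<bar>) / 2"

lemma energy_commute: "energy w F G = energy w G F"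
  by (simp add: energy_def mult_ac)

lemma energy_add_left: "energy w (\<lambda>x. F x + G x) H = energy w F H + energy w G H"
  by (simp add: energy_def add_divide_distrib[symmetric] sum.distrib[symmetric] algebra_simps)

lemma energy_scale_left: "energy w (\<lambda>x. c * F x) H = c * energy w F H"
  by (simp add: energy_def sum_distrib_left algebra_simps)

lemma energy_add_right: "energy w H (\<lambda>x. F x + G x) = energy w H F + energy w H G"
  by (metis energy_add_left energy_commute)

lemma energy_scale_right: "energy w H (\<lambda>x. c * F x) = c * energy w H F"
  by (metis energy_scale_left energy_commute)

lemma energy_const_right: "energy w F (\<lambda>_. c) = 0"
  by (simp add: energy_def)

lemma sum_times_indicator: "(\<Sum>x\<in>UNIV. f x * indicator S x) = sum f S"
  for f :: "'v::finite \<Rightarrow> real"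
proof -
  have "sum f S = (\<Sum>x\<in>UNIV. if x \<in> S then f x else 0)"
    by (simp add: sum.If_cases)
  also have "\<dots> = (\<Sum>x\<in>UNIV. f x * indicator S x)"
    by (intro sum.cong) auto
  finally show ?thesis by simp
qed

lemma sum_restrict_measure:
  "sum (\<lambda>x. restrict_measure B \<mu> x * F x) UNIV = (\<Sum>x\<in>B. \<mu> x * F x)" for B :: "'v::finite set"
  unfolding restrict_measure_def sum_times_indicator[symmetric, of _ B] by (simp add: mult_ac)

context weighted_graph
begin

lemma measure_nonzero: "\<mu> x \<noteq> 0"
  using measure_pos[of x] by simp

lemma energy_nonneg: "energy w F F \<ge> 0"
  unfolding energy_def using weight_nonneg
  by (auto intro!: sum_nonneg divide_nonneg_pos simp: mult.assoc)

text \<open>Summation by parts: exchanging the two end points of an edge changes the sign of the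
  increment of \<open>F\<close>.\<close>
lemma green_formula: "(\<Sum>x\<in>UNIV. G x * outflow w F x) = energy w F G"
proof -
  let ?a = "\<lambda>x y. w x y * (F x - F y)"
  have "(\<Sum>x\<in>UNIV. \<Sum>y\<in>UNIV. ?a x y * G y) = (\<Sum>y\<in>UNIV. \<Sum>x\<in>UNIV. ?a x y * G y)"
    by (rule sum.swap)
  also have "\<dots> = - (\<Sum>x\<in>UNIV. \<Sum>y\<in>UNIV. ?a x y * G x)"
    by (subst weight_sym) (simp add: sum_negf[symmetric] algebra_simps)
  finally have swap: "(\<Sum>x\<in>UNIV. \<Sum>y\<in>UNIV. ?a x y * G y) = - (\<Sum>x\<in>UNIV. \<Sum>y\<in>UNIV. ?a x y * G x)" .
  have "2 * energy w F G = (\<Sum>x\<in>UNIV. \<Sum>y\<in>UNIV. ?a x y * G x) - (\<Sum>x\<in>UNIV. \<Sum>y\<in>UNIV. ?a x y * G y)"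
    by (simp add: energy_def sum_subtractf[symmetric] right_diff_distrib)
  also have "\<dots> = 2 * (\<Sum>x\<in>UNIV. \<Sum>y\<in>UNIV. ?a x y * G x)"
    by (simp add: swap)
  also have "(\<Sum>x\<in>UNIV. \<Sum>y\<in>UNIV. ?a x y * G x) = (\<Sum>x\<in>UNIV. G x * outflow w F x)"
    by (simp add: outflow_def sum_distrib_left mult_ac)
  finally show ?thesis by simp
qed

lemma cut_weight_eq_total_variation: "cut_weight w A (- A) = total_variation w (indicator A)"
proof -
  have cut: "cut_weight w A A' = (\<Sum>x\<in>UNIV. \<Sum>y\<in>UNIV. w x y * (indicator A x * indicator A' y))" for A A'
  proof -
    have "(\<Sum>y\<in>UNIV. w x y * (indicator A x * indicator A' y)) = (\<Sum>y\<in>A'. w x y) * indicator A x" for x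
      using sum_times_indicator[of "\<lambda>y. w x y * indicator A x" A']
      by (simp only: mult.assoc sum_distrib_right)
    then show ?thesis
      using sum_times_indicator[of "\<lambda>x. \<Sum>y\<in>A'. w x y" A] by (simp only: cut_weight_def)
  qed
  have "cut_weight w (- A) A = (\<Sum>y\<in>A. \<Sum>x\<in>- A. w x y)"
    unfolding cut_weight_def by (rule sum.swap)
  also have "\<dots> = cut_weight w A (- A)"
    unfolding cut_weight_def by (intro sum.cong refl weight_sym)
  finally have "2 * cut_weight w A (- A) = cut_weight w A (- A) + cut_weight w (- A) A" by simp
  also have "\<dots> = (\<Sum>x\<in>UNIV. \<Sum>y\<in>UNIV. w x y * \<bar>indicator A x - indicator A y\<bar>)"
    unfolding cut sum.distrib[symmetric] by (intro sum.cong) (auto simp: indicator_def)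
  finally show ?thesis by (simp add: total_variation_def)
qed

text \<open>Increments of an indicator have absolute value \<open>0\<close> or \<open>1\<close> and so equal their squares.\<close>
lemma cut_weight_eq_energy: "cut_weight w A (- A) = energy w (indicator A) (indicator A)"
  unfolding cut_weight_eq_total_variation total_variation_def energy_def
  by (intro arg_cong[where f = "\<lambda>x. x / 2"] sum.cong) (auto simp: indicator_def)

lemma cut_weight_nonneg: "cut_weight w A A' \<ge> 0"
  using weight_nonneg by (auto simp: cut_weight_def intro!: sum_nonneg)

text \<open>The discrete co-area argument. Subtracting from \<open>\<phi>\<close> its least positive value \<open>a\<close> on its support
  \<open>S\<close> gives a function with smaller support, whose superlevel sets are superlevel sets of \<open>\<phi>\<close>. Both
  sides are additive along this step: the left one loses \<open>a k m(S)\<close>, the right one loses \<open>a\<close> times the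
  cut weight of \<open>S\<close>.\<close>
lemma layer_cake_bound:
  assumes "\<And>x. \<phi> x \<ge> 0"
    and "\<And>t. t \<ge> 0 \<Longrightarrow> k * sum m {x. \<phi> x > t} \<le> cut_weight w {x. \<phi> x > t} (- {x. \<phi> x > t})"
  shows "k * (\<Sum>x\<in>UNIV. m x * \<phi> x) \<le> total_variation w \<phi>"
  using assms
proof (induction "card {x. \<phi> x > 0}" arbitrary: \<phi> rule: less_induct)
  case less
  define S where "S = {x. \<phi> x > 0}"
  have off: "\<phi> x = 0" if "x \<notin> S" for x using that less.prems(1)[of x] by (simp add: S_def)
  show ?case
  proof (cases "S = {}")
    case True
    then show ?thesis using off by (simp add: total_variation_def)
  next
    case False
    define a where "a = Min (\<phi> ` S)"
    have a_le: "a \<le> \<phi> x" if "x \<in> S" for x using that by (simp add: a_def)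
    have "a \<in> \<phi> ` S" unfolding a_def using False by (intro Min_in) auto
    then obtain x0 where x0: "x0 \<in> S" "\<phi> x0 = a" by auto
    then have a: "a > 0" by (auto simp: S_def)
    \<comment> \<open>On \<open>S\<close> the function drops by \<open>a\<close>; off \<open>S\<close> it stays zero.\<close>
    define \<psi> where "\<psi> x = \<phi> x - a * indicator S x" for x
    have \<psi>_nonneg: "\<psi> x \<ge> 0" for x
      using a_le off by (cases "x \<in> S") (auto simp: \<psi>_def)
    have level: "{x. \<psi> x > t} = {x. \<phi> x > t + a}" if "t \<ge> 0" for t
      using that a by (auto simp: \<psi>_def S_def indicator_def split: if_splits)
    have "{x. \<psi> x > 0} \<subset> {x. \<phi> x > 0}"
      unfolding level[OF order_refl] using a x0 by (auto simp: S_def)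
    then have "card {x. \<psi> x > 0} < card {x. \<phi> x > 0}" by (intro psubset_card_mono) auto
    then have "k * (\<Sum>x\<in>UNIV. m x * \<psi> x) \<le> total_variation w \<psi>"
    proof (rule less.hyps[OF _ \<psi>_nonneg])
      show "k * sum m {x. \<psi> x > t} \<le> cut_weight w {x. \<psi> x > t} (- {x. \<psi> x > t})" if "t \<ge> 0" for t
        unfolding level[OF that] using a that by (intro less.prems(2)) simp
    qed
    moreover have "a * (k * sum m S) \<le> a * total_variation w (indicator S)"
      using less.prems(2)[of 0] a by (simp add: S_def[symmetric] cut_weight_eq_total_variation)
    moreover have "(\<Sum>x\<in>UNIV. m x * \<phi> x) = (\<Sum>x\<in>UNIV. m x * \<psi> x) + a * sum m S"
    proof -
      have "(\<Sum>x\<in>UNIV. m x * \<phi> x) = (\<Sum>x\<in>UNIV. m x * \<psi> x + a * m x * indicator S x)"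
        by (intro sum.cong) (simp_all add: \<psi>_def algebra_simps)
      then show ?thesis
        using sum_times_indicator[of "\<lambda>x. a * m x" S]
        by (simp only: sum.distrib sum_distrib_left)
    qed
    moreover have "total_variation w \<phi> = total_variation w \<psi> + a * total_variation w (indicator S)"
    proof -
      have "\<bar>\<phi> x - \<phi> y\<bar> = \<bar>\<psi> x - \<psi> y\<bar> + a * \<bar>indicator S x - indicator S y\<bar>" for x y
        using a a_le[of x] a_le[of y] off[of x] off[of y]
        by (cases "x \<in> S"; cases "y \<in> S") (auto simp: \<psi>_def)
      then show ?thesis
        by (simp add: total_variation_def distrib_left sum.distrib sum_distrib_left
            add_divide_distrib mult.left_commute)
    qed
    ultimately show ?thesis by (simp add: algebra_simps)
  qed
qed

lemma vertex_degree_eq: "vertex_degree w x = (\<Sum>y\<in>UNIV. w x y)"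
  unfolding vertex_degree_def by (simp add: sum.remove[of UNIV x] weight_loop)

text \<open>Factor \<open>|g(x)\<^sup>2 - g(y)\<^sup>2| = |g(x) - g(y)| |g(x) + g(y)|\<close> and apply Cauchy-Schwarz to the sum over
  ordered pairs. The second factor is controlled by \<open>(g(x) + g(y))\<^sup>2 \<le> 2 g(x)\<^sup>2 + 2 g(y)\<^sup>2\<close>, whose
  weighted sum is four times the degree-weighted norm.\<close>
lemma total_variation_square_bound:
  "(total_variation w (\<lambda>x. (g x)\<^sup>2))\<^sup>2 \<le> 2 * energy w g g * (\<Sum>x\<in>UNIV. vertex_degree w x * (g x)\<^sup>2)"
proof -
  let ?I = "UNIV :: ('v \<times> 'v) set"
  let ?s = "\<lambda>(x, y). sqrt (w x y) * \<bar>g x - g y\<bar>"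
  let ?t = "\<lambda>(x, y). sqrt (w x y) * \<bar>g x + g y\<bar>"
  have pairs: "(\<Sum>x\<in>UNIV. \<Sum>y\<in>UNIV. h x y) = (\<Sum>(x, y)\<in>?I. h x y)" for h :: "'v \<Rightarrow> 'v \<Rightarrow> real"
    by (simp add: sum.cartesian_product)
  have sqrt_sq: "sqrt (w x y) * (sqrt (w x y) * r) = w x y * r" for x y r
    using weight_nonneg[of x y] by (simp add: mult.assoc[symmetric])
  have TV: "2 * total_variation w (\<lambda>x. (g x)\<^sup>2) = (\<Sum>p\<in>?I. ?s p * ?t p)"
    unfolding total_variation_def
    by (simp add: pairs case_prod_beta mult_ac sqrt_sq abs_mult[symmetric] power2_eq_square
        square_diff_square_factored)
  have E: "(\<Sum>p\<in>?I. (?s p)\<^sup>2) = 2 * energy w g g"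
    unfolding energy_def
    by (simp add: pairs case_prod_beta power_mult_distrib weight_nonneg power2_eq_square mult_ac sqrt_sq)
  have deg1: "(\<Sum>x\<in>UNIV. \<Sum>y\<in>UNIV. w x y * (g x)\<^sup>2) = (\<Sum>x\<in>UNIV. vertex_degree w x * (g x)\<^sup>2)"
    by (simp add: vertex_degree_eq sum_distrib_right)
  have deg2: "(\<Sum>x\<in>UNIV. \<Sum>y\<in>UNIV. w x y * (g y)\<^sup>2) = (\<Sum>x\<in>UNIV. vertex_degree w x * (g x)\<^sup>2)"
    by (subst sum.swap, subst weight_sym) (rule deg1)
  have "(\<Sum>p\<in>?I. (?t p)\<^sup>2) = (\<Sum>x\<in>UNIV. \<Sum>y\<in>UNIV. w x y * (g x + g y)\<^sup>2)"
    by (simp add: pairs case_prod_beta power_mult_distrib weight_nonneg)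
  also have "\<dots> \<le> (\<Sum>x\<in>UNIV. \<Sum>y\<in>UNIV. w x y * (2 * (g x)\<^sup>2 + 2 * (g y)\<^sup>2))"
  proof (intro sum_mono mult_left_mono weight_nonneg)
    fix x y show "(g x + g y)\<^sup>2 \<le> 2 * (g x)\<^sup>2 + 2 * (g y)\<^sup>2"
      using zero_le_power2[of "g x - g y"] by (simp add: power2_sum power2_diff)
  qed
  also have "\<dots> = 2 * (\<Sum>x\<in>UNIV. \<Sum>y\<in>UNIV. w x y * (g x)\<^sup>2) + 2 * (\<Sum>x\<in>UNIV. \<Sum>y\<in>UNIV. w x y * (g y)\<^sup>2)"
    by (simp add: distrib_left sum.distrib sum_distrib_left mult_ac)
  finally have D: "(\<Sum>p\<in>?I. (?t p)\<^sup>2) \<le> 4 * (\<Sum>x\<in>UNIV. vertex_degree w x * (g x)\<^sup>2)"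
    by (simp add: deg1 deg2)
  have "(2 * total_variation w (\<lambda>x. (g x)\<^sup>2))\<^sup>2 \<le> (\<Sum>p\<in>?I. (?s p)\<^sup>2) * (\<Sum>p\<in>?I. (?t p)\<^sup>2)"
    unfolding TV by (rule Cauchy_Schwarz_ineq_sum)
  also have "\<dots> \<le> (2 * energy w g g) * (4 * (\<Sum>x\<in>UNIV. vertex_degree w x * (g x)\<^sup>2))"
    unfolding E using D energy_nonneg[of g] by (intro mult_left_mono) auto
  finally show ?thesis by (simp add: power_mult_distrib)
qed

end

section \<open>Cheeger constants\<close>

text \<open>An infimum of reals over the empty set is an arbitrary number, so a lower bound needs an
  admissible set \<open>A0\<close> as a witness.\<close>
lemma cheeger_greatest:
  assumes "sum m A0 > 0" "sum \<nu> A0 \<le> sum \<nu> UNIV / 2"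
    and "\<And>A. sum m A > 0 \<Longrightarrow> sum \<nu> A \<le> sum \<nu> UNIV / 2 \<Longrightarrow> c \<le> cut_weight w A (- A) / sum m A"
  shows "c \<le> cheeger w m \<nu>"
  unfolding cheeger_def using assms by (intro cInf_greatest) auto

text \<open>In this multiplied form the defining inequality extends to sets \<open>A\<close> of \<open>m\<close>-measure zero, which the
  superlevel sets used below may be.\<close>
lemma (in weighted_graph) cheeger_mult_le_cut:
  assumes "\<And>x. m x \<ge> 0" "sum \<nu> A \<le> sum \<nu> UNIV / 2"
  shows "cheeger w m \<nu> * sum m A \<le> cut_weight w A (- A)"
proof (cases "sum m A > 0")
  case True
  have "cheeger w m \<nu> \<le> cut_weight w A (- A) / sum m A"
    unfolding cheeger_def
  proof (rule cInf_lower)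
    show "bdd_below {cut_weight w A (- A) / sum m A |A. 0 < sum m A \<and> sum \<nu> A \<le> sum \<nu> UNIV / 2}"
      by (rule bdd_belowI[of _ 0]) (auto intro!: divide_nonneg_pos cut_weight_nonneg)
  qed (use True assms in auto)
  then show ?thesis using True by (simp add: field_simps)
next
  case False
  then have "sum m A = 0" using assms(1) by (simp add: order_antisym sum_nonneg)
  then show ?thesis using cut_weight_nonneg by simp
qed

section \<open>Steklov modes\<close>

locale steklov_problem = weighted_graph w \<mu>
  for w :: "'v::finite \<Rightarrow> 'v \<Rightarrow> real" and \<mu> :: "'v \<Rightarrow> real" +
  fixes B :: "'v set"
  assumes connected: "graph_connected w" and card_boundary: "card B \<ge> 2"
begin

definition boundary_product :: "('v \<Rightarrow> real) \<Rightarrow> ('v \<Rightarrow> real) \<Rightarrow> real" where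
  "boundary_product F G = (\<Sum>x\<in>B. \<mu> x * F x * G x)"

lemma boundary_product_commute: "boundary_product F G = boundary_product G F"
  by (simp add: boundary_product_def mult_ac)

lemma boundary_product_add_left:
  "boundary_product (\<lambda>x. F x + G x) H = boundary_product F H + boundary_product G H"
  by (simp add: boundary_product_def sum.distrib[symmetric] algebra_simps)

lemma boundary_product_scale_left:
  "boundary_product (\<lambda>x. c * F x) H = c * boundary_product F H"
  by (simp add: boundary_product_def sum_distrib_left algebra_simps)

lemma boundary_product_add_right:
  "boundary_product H (\<lambda>x. F x + G x) = boundary_product H F + boundary_product H G"
  by (metis boundary_product_add_left boundary_product_commute)

lemma boundary_product_scale_right:
  "boundary_product H (\<lambda>x. c * F x) = c * boundary_product H F"
  by (metis boundary_product_scale_left boundary_product_commute)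

lemma boundary_nonempty: "B \<noteq> {}"
  using card_boundary by auto

lemma boundary_product_nonneg: "boundary_product F F \<ge> 0"
  unfolding boundary_product_def using measure_pos
  by (auto intro!: sum_nonneg simp: mult.assoc less_imp_le)

lemma boundary_product_pos_iff: "boundary_product F F > 0 \<longleftrightarrow> (\<exists>x\<in>B. F x \<noteq> 0)"
proof -
  have "boundary_product F F = 0 \<longleftrightarrow> (\<forall>x\<in>B. \<mu> x * F x * F x = 0)"
    unfolding boundary_product_def using measure_pos
    by (intro sum_nonneg_eq_0_iff) (auto simp: mult.assoc less_imp_le)
  also have "\<dots> \<longleftrightarrow> (\<forall>x\<in>B. F x = 0)"
    using measure_pos by (metis less_irrefl mult_eq_0_iff)
  finally show ?thesis using boundary_product_nonneg[of F] by auto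
qed

text \<open>Vanishing energy forces equality along every edge; connectedness spreads it to all vertices.\<close>
lemma energy_eq_0_imp_const:
  assumes "energy w F F = 0"
  shows "F x = F y"
proof -
  have "(\<Sum>x\<in>UNIV. \<Sum>y\<in>UNIV. w x y * (F x - F y) * (F x - F y)) = 0"
    using assms by (simp add: energy_def)
  then have "w x y * (F x - F y) * (F x - F y) = 0" for x y
    using weight_nonneg
    by (subst (asm) sum_nonneg_eq_0_iff) (auto intro!: sum_nonneg simp: mult.assoc sum_nonneg_eq_0_iff)
  then have step: "F x = F y" if "w x y > 0" for x y
    using that by (metis mult_eq_0_iff less_irrefl right_minus_eq)
  have "(x, y) \<in> {(u, v). w u v > 0}\<^sup>*"
    using connected by (auto simp: graph_connected_def)
  then show ?thesis
    by (induction rule: rtrancl_induct) (auto dest: step)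
qed

text \<open>\<open>F\<close> is defined on the whole vertex set. Off \<open>B\<close> the right-hand side vanishes, so the
  equation contains the harmonicity of \<open>F\<close>.\<close>
definition steklov_mode :: "real \<Rightarrow> ('v \<Rightarrow> real) \<Rightarrow> bool" where
  "steklov_mode \<sigma> F \<longleftrightarrow> (\<forall>x. outflow w F x = \<sigma> * restrict_measure B \<mu> x * F x)"

text \<open>The weak form of the eigenvalue equation, from Green's formula.\<close>
lemma energy_mode:
  assumes "steklov_mode \<sigma> F"
  shows "energy w F G = \<sigma> * boundary_product F G"
proof -
  have "energy w F G = (\<Sum>x\<in>UNIV. restrict_measure B \<mu> x * (\<sigma> * F x * G x))"
    using assms by (simp add: green_formula[symmetric] steklov_mode_def mult_ac)
  then show ?thesis
    unfolding sum_restrict_measure by (simp add: boundary_product_def sum_distrib_left mult_ac)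
qed

lemma mode_balanced:
  assumes "steklov_mode \<sigma> F" "\<sigma> > 0"
  shows "boundary_product F (\<lambda>_. 1) = 0"
  using energy_mode[OF assms(1), of "\<lambda>_. 1"] assms(2) by (simp add: energy_const_right)

lemma modes_orthogonal:
  assumes "steklov_mode \<sigma> F" "steklov_mode \<sigma>' G" "\<sigma> \<noteq> \<sigma>'"
  shows "boundary_product F G = 0"
  using energy_mode[OF assms(1), of G] energy_mode[OF assms(2), of F] assms(3)
  by (simp add: energy_commute boundary_product_commute)

lemma constant_mode: "steklov_mode 0 (\<lambda>_. c)"
  by (simp add: steklov_mode_def outflow_def)

definition positive_eigenvalues :: "real set" where
  "positive_eigenvalues = {\<sigma>. \<sigma> > 0 \<and> (\<exists>F. steklov_mode \<sigma> F \<and> (\<exists>x\<in>B. F x \<noteq> 0))}"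

text \<open>Modes of distinct eigenvalues are orthogonal on \<open>B\<close>, and after scaling by \<open>sqrt \<mu>\<close> this is
  Euclidean orthogonality, which only finitely many nonzero vectors can satisfy pairwise.\<close>
lemma finite_positive_eigenvalues: "finite positive_eigenvalues"
proof -
  have "\<forall>\<sigma>\<in>positive_eigenvalues. \<exists>F. steklov_mode \<sigma> F \<and> (\<exists>x\<in>B. F x \<noteq> 0)"
    by (simp add: positive_eigenvalues_def)
  from bchoice[OF this] obtain F
    where F: "\<forall>\<sigma>\<in>positive_eigenvalues. steklov_mode \<sigma> (F \<sigma>) \<and> (\<exists>x\<in>B. F \<sigma> x \<noteq> 0)"
    by (rule exE)
  define e :: "real \<Rightarrow> real ^ 'v" where
    "e \<sigma> = (\<chi> x. if x \<in> B then sqrt (\<mu> x) * F \<sigma> x else 0)" for \<sigma>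
  have inner: "e \<sigma> \<bullet> e \<sigma>' = boundary_product (F \<sigma>) (F \<sigma>')" for \<sigma> \<sigma>'
  proof -
    have "e \<sigma> \<bullet> e \<sigma>' = (\<Sum>x\<in>UNIV. if x \<in> B then \<mu> x * F \<sigma> x * F \<sigma>' x else 0)"
      unfolding inner_vec_def e_def using measure_pos
      by (intro sum.cong) (auto simp: less_imp_le algebra_simps real_sqrt_mult_self)
    then show ?thesis by (simp add: boundary_product_def sum.If_cases)
  qed
  have orth: "e \<sigma> \<bullet> e \<sigma>' = 0" if "\<sigma> \<in> positive_eigenvalues" "\<sigma>' \<in> positive_eigenvalues" "\<sigma> \<noteq> \<sigma>'" for \<sigma> \<sigma>'
    unfolding inner using that F by (blast intro: modes_orthogonal)
  have nz: "e \<sigma> \<bullet> e \<sigma> \<noteq> 0" if "\<sigma> \<in> positive_eigenvalues" for \<sigma>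
    using F that boundary_product_pos_iff[of "F \<sigma>"] by (auto simp: inner)
  have "inj_on e positive_eigenvalues"
    using orth nz by (metis inj_onI)
  moreover have "pairwise orthogonal (e ` positive_eigenvalues)"
    using orth by (auto simp: pairwise_def orthogonal_def)
  ultimately show ?thesis
    using pairwise_orthogonal_imp_finite finite_imageD by blast
qed

section \<open>The Rayleigh quotient\<close>

text \<open>The first-order condition at a minimum of a quadratic polynomial.\<close>
lemma linear_part_zero:
  fixes b c :: real
  assumes "\<And>t. 2 * t * b + t\<^sup>2 * c \<ge> 0"
  shows "b = 0"
proof (rule ccontr)
  assume b: "b \<noteq> 0"
  have c: "c \<ge> 0" using assms[of 1] assms[of "-1"] by simp
  \<comment> \<open>The shift by one avoids a division by zero when \<open>c = 0\<close>.\<close>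
  define t where "t = - b / (c + 1)"
  have t: "t * (c + 1) = - b" using c by (simp add: t_def)
  have "(c + 1)\<^sup>2 * (2 * t * b + t\<^sup>2 * c) = 2 * (t * (c + 1)) * (c + 1) * b + (t * (c + 1))\<^sup>2 * c"
    by (simp add: power2_eq_square algebra_simps)
  also have "\<dots> = - (b\<^sup>2 * (c + 2))"
    unfolding t by (simp add: power2_eq_square algebra_simps)
  also have "\<dots> < 0" using b c by simp
  finally show False using assms[of t] by (simp add: mult_less_0_iff)
qed

text \<open>The energy vanishes only on constants, and the boundary product detects those.\<close>
lemma energy_plus_boundary_pos:
  assumes "F x \<noteq> 0"
  shows "energy w F F + boundary_product F F > 0"
proof (rule ccontr)
  assume "\<not> ?thesis"
  then have "energy w F F = 0" "boundary_product F F \<le> 0"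
    using energy_nonneg[of F] boundary_product_nonneg[of F] by linarith+
  then show False
    using energy_eq_0_imp_const[of F x] boundary_product_pos_iff[of F] boundary_nonempty assms
    by (metis all_not_in_conv leD)
qed

text \<open>The test function has opposite masses at two vertices of \<open>B\<close>. It makes the minimisation over balanced
  functions below meaningful, and with it the existence of a positive eigenvalue.\<close>
lemma exists_balanced: "\<exists>F. boundary_product F (\<lambda>_. 1) = 0 \<and> boundary_product F F > 0"
proof -
  obtain a b where ab: "a \<in> B" "b \<in> B" "a \<noteq> b"
    using card_boundary
    by (metis card_le_Suc0_iff_eq finite not_less_eq_eq numeral_2_eq_2)
  define F where "F x = (if x = a then 1 / \<mu> a else if x = b then - 1 / \<mu> b else 0)" for x
  have "boundary_product F (\<lambda>_. 1) = (\<Sum>x\<in>B. (if x = a then 1 else 0) + (if x = b then - 1 else 0))"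
    unfolding boundary_product_def F_def using ab measure_pos
    by (intro sum.cong) (auto simp: less_imp_neq[symmetric])
  also have "\<dots> = 0" using ab by (simp add: sum.distrib)
  finally show ?thesis
    using ab measure_pos[of a] by (intro exI[of _ F]) (auto simp: boundary_product_pos_iff F_def)
qed

text \<open>The quotient \<open>E / M\<close> is undefined where \<open>F\<close> vanishes on \<open>B\<close>, and normalising by \<open>M F = 1\<close> leaves
  \<open>F\<close> unbounded off \<open>B\<close>. The quotient \<open>M / (E + M)\<close> is better: it is continuous on the Euclidean unit
  sphere, and a maximum \<open>m\<close> of it is a minimum \<open>(1 - m) / m\<close> of \<open>E / M\<close>. At a maximiser \<open>F\<close> the
  form \<open>m E - (1 - m) M\<close>, which is non-negative on balanced functions, attains zero, so its polar
  form vanishes in all balanced directions. It vanishes in the constant direction too, hence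
  everywhere, which is the eigenvalue equation in weak form.\<close>
lemma rayleigh_minimizer:
  obtains \<sigma> where "\<sigma> \<in> positive_eigenvalues"
    "\<And>F. boundary_product F (\<lambda>_. 1) = 0 \<Longrightarrow> \<sigma> * boundary_product F F \<le> energy w F F"
proof -
  let ?W = "\<lambda>F. boundary_product F (\<lambda>_. 1) = 0"
  define E where "E F = energy w F F" for F
  define M where "M F = boundary_product F F" for F
  define K where "K = {v :: real ^ 'v. norm v = 1} \<inter> {v. ?W (($) v)}"
  define q where "q v = M (($) v) / (E (($) v) + M (($) v))" for v :: "real ^ 'v"
  \<comment> \<open>\<open>q\<close> is homogeneous of degree zero, so its bounds on the sphere hold for all functions.\<close>
  have normalize: "(1 / norm (vec_lambda F)) *\<^sub>R vec_lambda F \<in> K \<and>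
      q ((1 / norm (vec_lambda F)) *\<^sub>R vec_lambda F) = M F / (E F + M F)"
    if "?W F" "F x \<noteq> 0" for F x
  proof -
    let ?v = "vec_lambda F :: real ^ 'v"
    define c where "c = 1 / norm ?v"
    have nz: "?v \<noteq> 0" using that by (metis vec_lambda_beta zero_index)
    then have c: "c \<noteq> 0" by (simp add: c_def)
    have comp: "($) (c *\<^sub>R ?v) = (\<lambda>x. c * F x)" by auto
    have "q (c *\<^sub>R ?v) = (c\<^sup>2 * M F) / (c\<^sup>2 * (E F + M F))"
      unfolding q_def comp E_def M_def
      by (simp add: energy_scale_left energy_scale_right boundary_product_scale_left
          boundary_product_scale_right power2_eq_square algebra_simps)
    then have "q (c *\<^sub>R ?v) = M F / (E F + M F)" using c by simp
    moreover have "c *\<^sub>R ?v \<in> K"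
      unfolding K_def mem_Collect_eq Int_iff comp boundary_product_scale_left
      using that nz by (simp add: c_def)
    ultimately show ?thesis by (simp add: c_def)
  qed
  have pos: "E (($) v) + M (($) v) > 0" if "v \<in> K" for v
  proof -
    have "v \<noteq> 0" using that by (auto simp: K_def)
    then obtain x where "v $ x \<noteq> 0" by (auto simp: vec_eq_iff)
    then show ?thesis unfolding E_def M_def by (rule energy_plus_boundary_pos[of "($) v"])
  qed
  obtain F1 where F1: "?W F1" "M F1 > 0" using exists_balanced by (auto simp: M_def)
  then obtain x1 where x1: "F1 x1 \<noteq> 0" by (auto simp: M_def boundary_product_pos_iff)
  have "compact K"
  proof -
    have "compact {v :: real ^ 'v. norm v = 1}"
      using compact_sphere[of "0 :: real ^ 'v" 1] by (simp add: sphere_def dist_norm)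
    moreover have "closed {v :: real ^ 'v. ?W (($) v)}"
      unfolding boundary_product_def by (intro closed_Collect_eq continuous_intros)
    ultimately show ?thesis unfolding K_def by (rule compact_Int_closed)
  qed
  moreover have "K \<noteq> {}" using normalize[OF F1(1) x1] by auto
  moreover have "continuous_on K q"
    unfolding q_def
  proof (intro continuous_on_divide ballI)
    show "continuous_on K (\<lambda>v. M (($) v))"
      unfolding M_def boundary_product_def by (intro continuous_intros)
    then show "continuous_on K (\<lambda>v. E (($) v) + M (($) v))"
      unfolding E_def energy_def by (intro continuous_intros) auto
  qed (use pos in force)
  ultimately obtain v where v: "v \<in> K" "\<And>u. u \<in> K \<Longrightarrow> q u \<le> q v"
    using continuous_attains_sup by metis
  define F where "F = ($) v"
  define m where "m = q v"
  have W: "?W F" using v by (simp add: K_def F_def)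
  have EM: "E F + M F > 0" using pos[OF v(1)] by (simp add: F_def)
  have "M F1 / (E F1 + M F1) \<le> m"
    using normalize[OF F1(1) x1] v(2) by (metis m_def)
  moreover have "M F1 / (E F1 + M F1) > 0"
    using F1 energy_nonneg[of F1] by (simp add: E_def add_nonneg_pos)
  ultimately have m: "m > 0" by linarith
  have mF: "m * E F - (1 - m) * M F = 0"
    using EM by (simp add: m_def q_def F_def[symmetric] field_simps)
  have Q_nonneg: "m * E G - (1 - m) * M G \<ge> 0" if "?W G" for G
  proof (cases "\<exists>x. G x \<noteq> 0")
    case True
    then obtain x where x: "G x \<noteq> 0" by blast
    have "M G / (E G + M G) \<le> m"
      using normalize[OF that x] v(2) by (metis m_def)
    then show ?thesis
      using energy_plus_boundary_pos[of G, OF x] by (simp add: E_def M_def field_simps)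
  next
    case False
    then show ?thesis by (simp add: E_def M_def energy_def boundary_product_def)
  qed
  have stationary_W: "m * energy w F G - (1 - m) * boundary_product F G = 0" if "?W G" for G
  proof (rule linear_part_zero)
    fix t :: real
    have "?W (\<lambda>x. F x + t * G x)"
      using W that by (simp add: boundary_product_add_left boundary_product_scale_left)
    from Q_nonneg[OF this] mF
    show "2 * t * (m * energy w F G - (1 - m) * boundary_product F G)
        + t\<^sup>2 * (m * E G - (1 - m) * M G) \<ge> 0"
      by (simp add: E_def M_def energy_add_left energy_add_right energy_scale_left
          energy_scale_right boundary_product_add_left boundary_product_add_right
          boundary_product_scale_left boundary_product_scale_right energy_commute[of w G F]
          boundary_product_commute[of G F] power2_eq_square algebra_simps)
  qed
  have stationary: "m * energy w F G - (1 - m) * boundary_product F G = 0" for G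
  proof -
    define c where "c = boundary_product G (\<lambda>_. 1) / boundary_product (\<lambda>_. 1) (\<lambda>_. 1)"
    have one: "boundary_product (\<lambda>_. 1) (\<lambda>_. 1) > 0"
      using boundary_nonempty by (subst boundary_product_pos_iff) auto
    have Fc: "boundary_product F (\<lambda>_. c) = 0"
      using W boundary_product_scale_right[of F c "\<lambda>_. 1"] by simp
    have "?W (\<lambda>x. G x + (- c) * 1)"
      unfolding boundary_product_add_left boundary_product_scale_left
      using one by (simp add: c_def)
    from stationary_W[OF this] show ?thesis
      using W by (simp only: energy_add_right boundary_product_add_right energy_scale_right
          boundary_product_scale_right energy_const_right) simp
  qed
  define \<sigma> where "\<sigma> = (1 - m) / m"
  have EG: "energy w F G = \<sigma> * boundary_product F G" for G
    using stationary[of G] m by (simp add: \<sigma>_def field_simps)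
  have "outflow w F x = \<sigma> * restrict_measure B \<mu> x * F x" for x
  proof -
    have "energy w F (indicator {x}) = outflow w F x"
      by (simp add: green_formula[symmetric])
    moreover have "boundary_product F (indicator {x}) = restrict_measure B \<mu> x * F x"
      by (simp add: boundary_product_def restrict_measure_def indicator_def if_distrib
          cong: if_cong)
    ultimately show ?thesis using EG by simp
  qed
  then have mode: "steklov_mode \<sigma> F" by (simp add: steklov_mode_def)
  have MF: "M F > 0"
    using m EM boundary_product_nonneg[of F]
    by (simp add: m_def q_def F_def[symmetric] zero_less_divide_iff)
  have EF: "E F = \<sigma> * M F" using EG by (simp add: E_def M_def)
  have "E F > 0"
  proof (rule ccontr)
    assume "\<not> E F > 0"
    then have "E F = 0" using energy_nonneg[of F] by (simp add: E_def)
    then have const: "F x = F y" for x y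
      using energy_eq_0_imp_const by (simp add: E_def)
    have "M F = F undefined * boundary_product F (\<lambda>_. 1)"
      unfolding M_def boundary_product_scale_right[symmetric]
      using const by (metis mult.right_neutral)
    then show False using W MF by simp
  qed
  then have "\<sigma> > 0" using EF MF by (metis zero_less_mult_pos2)
  then have "\<sigma> \<in> positive_eigenvalues"
    using mode MF by (auto simp: positive_eigenvalues_def M_def boundary_product_pos_iff)
  moreover have "\<sigma> * boundary_product G G \<le> energy w G G" if "?W G" for G
    using Q_nonneg[OF that] m by (simp add: \<sigma>_def E_def M_def field_simps)
  ultimately show ?thesis by (rule that)
qed

section \<open>Real modes and the complex Steklov spectrum\<close>

lemma Re_laplacian: "Re (laplacian w \<mu> F $ x) = outflow w (\<lambda>y. Re (F $ y)) x / \<mu> x"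
  by (simp add: laplacian_def outflow_def Re_divide_of_real)

lemma Im_laplacian: "Im (laplacian w \<mu> F $ x) = outflow w (\<lambda>y. Im (F $ y)) x / \<mu> x"
  by (simp add: laplacian_def outflow_def Im_divide_of_real)

lemma laplacian_add: "laplacian w \<mu> (F + G) = laplacian w \<mu> F + laplacian w \<mu> G"
  by (simp add: laplacian_def vec_eq_iff add_diff_add distrib_left sum.distrib add_divide_distrib)

lemma laplacian_scaleR: "laplacian w \<mu> (c *\<^sub>R F) = c *\<^sub>R laplacian w \<mu> F"
  by (simp add: laplacian_def vec_eq_iff flip: scaleR_diff_right scaleR_sum_right)

text \<open>Uniqueness in the Dirichlet problem: \<open>u\<close> times its outflow vanishes at every vertex, so \<open>u\<close> has no
  energy and is constant.\<close>
lemma harmonic_zero_boundary_real: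
  assumes "\<And>x. x \<in> B \<Longrightarrow> u x = 0" "\<And>x. x \<notin> B \<Longrightarrow> outflow w u x = 0"
  shows "u x = 0"
proof -
  have "u y * outflow w u y = 0" for y
    using assms by (cases "y \<in> B") auto
  then have "energy w u u = 0"
    unfolding green_formula[symmetric] by (rule sum.neutral[rule_format])
  moreover obtain y where "y \<in> B" using boundary_nonempty by blast
  ultimately show ?thesis
    using energy_eq_0_imp_const[of u x y] assms(1) by simp
qed

lemma harmonic_zero_boundary:
  assumes "\<And>x. x \<in> B \<Longrightarrow> F $ x = 0" "\<And>x. x \<notin> B \<Longrightarrow> laplacian w \<mu> F $ x = 0"
  shows "F = 0"
proof -
  have "outflow w (\<lambda>y. Re (F $ y)) x = 0" "outflow w (\<lambda>y. Im (F $ y)) x = 0" if "x \<notin> B" for x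
    using Re_laplacian[of F x] Im_laplacian[of F x] assms(2)[OF that] measure_nonzero[of x] by simp_all
  then have "Re (F $ x) = 0" "Im (F $ x) = 0" for x
    using harmonic_zero_boundary_real[of "\<lambda>x. Re (F $ x)" x]
      harmonic_zero_boundary_real[of "\<lambda>x. Im (F $ x)" x] assms(1) by simp_all
  then show ?thesis by (simp add: vec_eq_iff complex_eq_iff)
qed

lemma harmonic_extension_eq:
  assumes "\<And>x. x \<in> B \<Longrightarrow> F $ x = f $ x" "\<And>x. x \<notin> B \<Longrightarrow> laplacian w \<mu> F $ x = 0"
  shows "harmonic_extension w \<mu> B f = F"
  unfolding harmonic_extension_def
proof (rule the_equality)
  fix G assume G: "(\<forall>x\<in>B. G $ x = f $ x) \<and> (\<forall>x\<in>- B. laplacian w \<mu> G $ x = 0)"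
  have lap: "laplacian w \<mu> (G + (- 1) *\<^sub>R F) = laplacian w \<mu> G + (- 1) *\<^sub>R laplacian w \<mu> F"
    by (simp only: laplacian_add laplacian_scaleR)
  have "G + (- 1) *\<^sub>R F = 0"
  proof (rule harmonic_zero_boundary)
    show "(G + (- 1) *\<^sub>R F) $ x = 0" if "x \<in> B" for x using G assms(1) that by simp
    show "laplacian w \<mu> (G + (- 1) *\<^sub>R F) $ x = 0" if "x \<notin> B" for x
      unfolding lap using G assms(2) that by simp
  qed
  then show "G = F" by simp
qed (use assms in auto)

text \<open>The map that takes boundary values on \<open>B\<close> and the Laplacian off \<open>B\<close> is an endomorphism of a
  finite-dimensional space, so the uniqueness just proved makes it surjective.\<close>
lemma harmonic_extension_exists:
  obtains F where "\<And>x. x \<in> B \<Longrightarrow> F $ x = f $ x" "\<And>x. x \<notin> B \<Longrightarrow> laplacian w \<mu> F $ x = 0"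
proof -
  define S where "S F = (\<chi> x. if x \<in> B then F $ x else laplacian w \<mu> F $ x)" for F
  have "linear S"
    by (rule linearI) (auto simp: S_def vec_eq_iff laplacian_add laplacian_scaleR)
  moreover have "F = 0" if "S F = 0" for F
    using that by (intro harmonic_zero_boundary) (auto simp: S_def vec_eq_iff split: if_splits)
  ultimately have "surj S"
    by (metis linear_injective_0 linear_injective_imp_surjective)
  then obtain F where "(\<chi> x. if x \<in> B then f $ x else 0) = S F" by (metis surjD)
  then have "(if x \<in> B then f $ x else 0) = (if x \<in> B then F $ x else laplacian w \<mu> F $ x)" for x
    by (simp add: S_def vec_eq_iff)
  then show ?thesis by (intro that[of F]) metis+
qed

text \<open>This form of the eigenvalue equation no longer mentions the definite description behind the harmonic
  extension.\<close>
lemma steklov_eigenspace_iff: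
  "f \<in> steklov_eigenspace w \<mu> B z \<longleftrightarrow> f \<in> functions_on B \<and>
    (\<exists>F. (\<forall>x\<in>B. F $ x = f $ x) \<and> (\<forall>x. laplacian w \<mu> F $ x = (if x \<in> B then z * F $ x else 0)))"
proof (cases "f \<in> functions_on B")
  case f: True
  obtain F where F: "\<And>x. x \<in> B \<Longrightarrow> F $ x = f $ x" "\<And>x. x \<notin> B \<Longrightarrow> laplacian w \<mu> F $ x = 0"
    using harmonic_extension_exists[of f] by blast
  have ext: "harmonic_extension w \<mu> B f = F" by (rule harmonic_extension_eq[OF F])
  have "steklov w \<mu> B f = z *s f \<longleftrightarrow> (\<forall>x. laplacian w \<mu> F $ x = (if x \<in> B then z * F $ x else 0))"
    using f F by (auto simp: steklov_def ext vec_eq_iff functions_on_def)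
  moreover have "G = F"
    if "\<forall>x\<in>B. G $ x = f $ x" "\<forall>x. laplacian w \<mu> G $ x = (if x \<in> B then z * G $ x else 0)" for G
    using that harmonic_extension_eq[of G f] ext by simp
  then have "(\<exists>F. (\<forall>x\<in>B. F $ x = f $ x) \<and> (\<forall>x. laplacian w \<mu> F $ x = (if x \<in> B then z * F $ x else 0)))
      \<longleftrightarrow> (\<forall>x. laplacian w \<mu> F $ x = (if x \<in> B then z * F $ x else 0))"
    using F(1) by blast
  ultimately show ?thesis
    using f by (simp add: steklov_eigenspace_def)
qed (simp add: steklov_eigenspace_def)

text \<open>For a complex eigenfunction with real part \<open>u\<close>, imaginary part \<open>v\<close> and eigenvalue \<open>a + \<i> b\<close>, computing
  the energy of \<open>u\<close> and \<open>v\<close> in both orders gives \<open>b (M u + M v) = 0\<close>. So \<open>b = 0\<close>, and \<open>u\<close> and \<open>v\<close>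
  are modes for \<open>a\<close>, one of them nonzero on \<open>B\<close>.\<close>
lemma steklov_eigenvalue_real_mode:
  assumes "z \<in> steklov_eigenvalues w \<mu> B"
  shows "z \<in> insert 0 (complex_of_real ` positive_eigenvalues)"
proof -
  obtain f F where f: "f \<in> functions_on B" "f \<noteq> 0" and Ff: "\<And>x. x \<in> B \<Longrightarrow> F $ x = f $ x"
    and F: "\<And>x. laplacian w \<mu> F $ x = (if x \<in> B then z * F $ x else 0)"
    using assms unfolding steklov_eigenvalues_def mem_Collect_eq Bex_def steklov_eigenspace_iff
    by blast
  define u where "u = (\<lambda>x. Re (F $ x))"
  define v where "v = (\<lambda>x. Im (F $ x))"
  define a where "a = Re z"
  define b where "b = Im z"
  have *: "outflow w u x / \<mu> x = (if x \<in> B then a * u x - b * v x else 0)" for x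
    using Re_laplacian[of F x] by (cases "x \<in> B") (simp_all add: F u_def v_def a_def b_def)
  have Lu: "outflow w u x = restrict_measure B \<mu> x * (a * u x - b * v x)" for x
    using measure_nonzero[of x] *[of x]
    by (cases "x \<in> B") (simp_all add: restrict_measure_def divide_eq_eq mult_ac)
  have *: "outflow w v x / \<mu> x = (if x \<in> B then a * v x + b * u x else 0)" for x
    using Im_laplacian[of F x] by (cases "x \<in> B") (simp_all add: F u_def v_def a_def b_def)
  have Lv: "outflow w v x = restrict_measure B \<mu> x * (a * v x + b * u x)" for x
    using measure_nonzero[of x] *[of x]
    by (cases "x \<in> B") (simp_all add: restrict_measure_def divide_eq_eq mult_ac)
  have "f $ x = 0" if "x \<notin> B" for x using f that by (simp add: functions_on_def)
  then obtain x0 where x0: "x0 \<in> B" "F $ x0 \<noteq> 0"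
    using f(2) Ff by (metis vec_eq_iff zero_index)
  then have uv: "u x0 \<noteq> 0 \<or> v x0 \<noteq> 0" by (auto simp: u_def v_def complex_eq_iff)
  have "energy w u v = (\<Sum>x\<in>UNIV. restrict_measure B \<mu> x * (v x * (a * u x - b * v x)))"
    by (simp add: green_formula[symmetric] Lu mult_ac)
  then have uv_energy: "energy w u v = a * boundary_product u v - b * boundary_product v v"
    unfolding sum_restrict_measure
    by (simp add: boundary_product_def sum_distrib_left sum_subtractf[symmetric] algebra_simps)
  have "energy w v u = (\<Sum>x\<in>UNIV. restrict_measure B \<mu> x * (u x * (a * v x + b * u x)))"
    by (simp add: green_formula[symmetric] Lv mult_ac)
  then have "energy w v u = a * boundary_product u v + b * boundary_product u u"
    unfolding sum_restrict_measure
    by (simp add: boundary_product_def sum_distrib_left sum.distrib[symmetric] algebra_simps)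
  with uv_energy have "b * (boundary_product u u + boundary_product v v) = 0"
    by (simp add: energy_commute[of w u v] algebra_simps)
  moreover have "boundary_product u u + boundary_product v v > 0"
    using uv x0(1) boundary_product_nonneg[of u] boundary_product_nonneg[of v]
      boundary_product_pos_iff[of u] boundary_product_pos_iff[of v]
    by (metis add_nonneg_pos add_pos_nonneg)
  ultimately have b: "b = 0" by auto
  obtain p where p: "steklov_mode a p" "p x0 \<noteq> 0"
    using uv Lu Lv b by (auto simp: steklov_mode_def mult_ac)
  have "a * boundary_product p p \<ge> 0"
    using energy_nonneg[of p] energy_mode[OF p(1), of p] by simp
  moreover have "boundary_product p p > 0"
    using p(2) x0(1) by (auto simp: boundary_product_pos_iff)
  ultimately have "a \<ge> 0" by (simp add: zero_le_mult_iff)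
  moreover have "z = complex_of_real a" using b by (simp add: a_def b_def complex_eq_iff)
  ultimately show ?thesis
    using p x0(1) unfolding positive_eigenvalues_def by (cases "a = 0") (auto intro!: imageI)
qed

lemma mode_imp_steklov_eigenvector:
  assumes "steklov_mode \<sigma> F"
  shows "(\<chi> x. if x \<in> B then complex_of_real (F x) else 0)
    \<in> steklov_eigenspace w \<mu> B (complex_of_real \<sigma>)"
proof -
  let ?F = "\<chi> x. complex_of_real (F x)"
  have "laplacian w \<mu> ?F $ x = (if x \<in> B then complex_of_real \<sigma> * ?F $ x else 0)" for x
    using assms measure_nonzero[of x]
    by (auto simp: complex_eq_iff Re_laplacian Im_laplacian steklov_mode_def restrict_measure_def)
      (simp_all add: outflow_def)
  then show ?thesis
    by (auto simp: steklov_eigenspace_iff functions_on_def intro!: exI[of _ ?F])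
qed

lemma steklov_eigenvalues_eq:
  "steklov_eigenvalues w \<mu> B = insert 0 (complex_of_real ` positive_eigenvalues)"
proof
  have "complex_of_real \<sigma> \<in> steklov_eigenvalues w \<mu> B"
    if "steklov_mode \<sigma> F" "x \<in> B" "F x \<noteq> 0" for \<sigma> F x
  proof -
    have "(\<chi> x. if x \<in> B then complex_of_real (F x) else 0) \<noteq> 0"
      using that(2,3) by (auto simp: vec_eq_iff)
    then show ?thesis
      using mode_imp_steklov_eigenvector[OF that(1)] by (auto simp: steklov_eigenvalues_def)
  qed
  from this[OF constant_mode[of 1]] this
  show "insert 0 (complex_of_real ` positive_eigenvalues) \<subseteq> steklov_eigenvalues w \<mu> B"
    using boundary_nonempty by (auto simp: positive_eigenvalues_def)
qed (use steklov_eigenvalue_real_mode in blast)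

lemma zero_eigenspace_dim: "vec.dim (steklov_eigenspace w \<mu> B 0) = 1"
proof -
  define e :: "complex ^ 'v" where "e = (\<chi> x. if x \<in> B then 1 else 0)"
  have "steklov_eigenspace w \<mu> B 0 = vec.span {e}"
  proof (intro equalityI subsetI)
    fix f assume "f \<in> steklov_eigenspace w \<mu> B 0"
    then obtain F where f: "f \<in> functions_on B" and Ff: "\<And>x. x \<in> B \<Longrightarrow> F $ x = f $ x"
      and F: "\<And>x. laplacian w \<mu> F $ x = 0"
      unfolding steklov_eigenspace_iff mult_zero_left if_cancel by blast
    have "outflow w (\<lambda>x. Re (F $ x)) x = 0" "outflow w (\<lambda>x. Im (F $ x)) x = 0" for x
      using Re_laplacian[of F x] Im_laplacian[of F x] measure_nonzero[of x] by (auto simp: F)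
    then have "energy w (\<lambda>x. Re (F $ x)) (\<lambda>x. Re (F $ x)) = 0"
      "energy w (\<lambda>x. Im (F $ x)) (\<lambda>x. Im (F $ x)) = 0"
      by (simp_all flip: green_formula)
    then have "F $ x = F $ y" for x y
      using energy_eq_0_imp_const[of "\<lambda>x. Re (F $ x)" x y]
        energy_eq_0_imp_const[of "\<lambda>x. Im (F $ x)" x y] by (simp add: complex_eq_iff)
    then have "f $ x = F $ undefined" if "x \<in> B" for x using Ff that by metis
    then have "f = (F $ undefined) *s e"
      using f by (auto simp: e_def vec_eq_iff functions_on_def)
    then show "f \<in> vec.span {e}"
      by (metis vec.span_base vec.span_scale singletonI)
  next
    fix f assume "f \<in> vec.span {e}"
    then obtain c where c: "f = c *s e" by (auto simp: vec.span_singleton)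
    show "f \<in> steklov_eigenspace w \<mu> B 0"
      unfolding steklov_eigenspace_iff
      by (auto simp: c e_def functions_on_def laplacian_def intro!: exI[of _ "\<chi> x. c"])
  qed
  moreover have "e \<noteq> 0" using boundary_nonempty by (auto simp: e_def vec_eq_iff)
  ultimately show ?thesis by simp
qed

text \<open>The eigenvalue \<open>0\<close> occupies exactly one place at the head of the sorted list. Whatever the other
  multiplicities are, the next entry is the least positive eigenvalue, provided that there is one.\<close>
lemma steklov_sigma_2_eq: "steklov_sigma w \<mu> B 2 = Min positive_eigenvalues"
proof -
  let ?d = "\<lambda>z. vec.dim (steklov_eigenspace w \<mu> B z)"
  define N where "N = (\<Sum>z\<in>complex_of_real ` positive_eigenvalues. replicate_mset (?d z) z)"
  have "complex_of_real \<sigma> \<in># N" if "\<sigma> \<in> positive_eigenvalues" for \<sigma>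
  proof -
    have "complex_of_real \<sigma> \<in> steklov_eigenvalues w \<mu> B" using that steklov_eigenvalues_eq by auto
    then have "?d (complex_of_real \<sigma>) \<noteq> 0" by (auto simp: steklov_eigenvalues_def)
    then show ?thesis using that finite_positive_eigenvalues by (auto simp: N_def set_mset_sum)
  qed
  moreover have "z \<in> complex_of_real ` positive_eigenvalues" if "z \<in># N" for z
    using that finite_positive_eigenvalues by (auto simp: N_def set_mset_sum split: if_splits)
  ultimately have "set_mset N = complex_of_real ` positive_eigenvalues" by auto
  then have set_N: "set_mset (image_mset Re N) = positive_eigenvalues" by (simp add: image_image)
  have "0 \<notin> complex_of_real ` positive_eigenvalues" by (auto simp: positive_eigenvalues_def)
  then have "steklov_spectrum w \<mu> B = add_mset 0 N"
    unfolding steklov_spectrum_def steklov_eigenvalues_eq N_def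
    using finite_positive_eigenvalues by (simp add: zero_eigenspace_dim)
  then have spec: "image_mset Re (steklov_spectrum w \<mu> B) = add_mset 0 (image_mset Re N)" by simp
  define ys where "ys = sorted_list_of_multiset (image_mset Re N)"
  have ys: "set ys = positive_eigenvalues" "sorted ys" by (simp_all add: ys_def set_N[simplified])
  moreover have ne: "positive_eigenvalues \<noteq> {}" using rayleigh_minimizer by blast
  ultimately obtain y ys' where y: "ys = y # ys'" by (cases ys) auto
  have "0 < y" using ys(1) y by (auto simp: positive_eigenvalues_def)
  then have "steklov_sigma w \<mu> B 2 = y"
    by (simp add: steklov_sigma_def spec ys_def[symmetric] y)
  also have "y = Min positive_eigenvalues"
    using ys y finite_positive_eigenvalues by (intro Min_eqI[symmetric]) auto
  finally show ?thesis .
qed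

section \<open>The two Cheeger inequalities\<close>

abbreviation boundary_measure :: "'v \<Rightarrow> real" where
  "boundary_measure \<equiv> restrict_measure B \<mu>"

lemma boundary_measure_nonneg: "boundary_measure x \<ge> 0"
  using measure_pos by (simp add: restrict_measure_def less_imp_le)

lemma sum_boundary_measure: "sum boundary_measure A = boundary_product (indicator A) (\<lambda>_. 1)"
  by (simp add: boundary_product_def restrict_measure_def indicator_def if_distrib sum.If_cases
      Int_commute cong: if_cong)

text \<open>Of any two vertices of \<open>B\<close>, the lighter one carries at most half of the boundary measure. This
  provides the admissible set that makes the Cheeger constant in the upper bound meaningful.\<close>
lemma light_boundary_vertex:
  obtains x where "x \<in> B" "sum boundary_measure {x} \<le> sum boundary_measure UNIV / 2"
proof -
  obtain a b where ab: "a \<in> B" "b \<in> B" "a \<noteq> b"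
    using card_boundary
    by (metis card_le_Suc0_iff_eq finite not_less_eq_eq numeral_2_eq_2)
  have "boundary_measure a + boundary_measure b = sum boundary_measure {a, b}" using ab by simp
  also have "\<dots> \<le> sum boundary_measure UNIV"
    using boundary_measure_nonneg by (intro sum_mono2) auto
  finally show ?thesis
    using that[of a] that[of b] ab by (cases "boundary_measure a \<le> boundary_measure b") auto
qed

text \<open>Test the Rayleigh quotient with \<open>1\<^sub>A - c\<close>, where \<open>c\<close> is the mean of \<open>1\<^sub>A\<close> over \<open>B\<close>.\<close>
lemma steklov_upper_bound:
  "steklov_sigma w \<mu> B 2 \<le> 2 * cheeger w boundary_measure boundary_measure"
proof -
  obtain \<sigma> where \<sigma>: "\<sigma> \<in> positive_eigenvalues"
    "\<And>F. boundary_product F (\<lambda>_. 1) = 0 \<Longrightarrow> \<sigma> * boundary_product F F \<le> energy w F F"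
    using rayleigh_minimizer by blast
  obtain x where x: "x \<in> B" "sum boundary_measure {x} \<le> sum boundary_measure UNIV / 2"
    by (rule light_boundary_vertex)
  have "\<sigma> / 2 \<le> cheeger w boundary_measure boundary_measure"
  proof (rule cheeger_greatest)
    show "0 < sum boundary_measure {x}"
      using x measure_pos by (simp add: restrict_measure_def)
    show "sum boundary_measure {x} \<le> sum boundary_measure UNIV / 2" by fact
    fix A assume A: "0 < sum boundary_measure A" "sum boundary_measure A \<le> sum boundary_measure UNIV / 2"
    define p where "p = sum boundary_measure A"
    define q where "q = sum boundary_measure UNIV"
    define c where "c = p / q"
    have pq: "0 < p" "p \<le> q / 2" using A by (simp_all add: p_def q_def)
    let ?F = "\<lambda>x. indicator A x + (- c) * 1"
    have one: "boundary_product (\<lambda>_. 1) (\<lambda>_. 1) = q"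
      by (simp add: q_def sum_boundary_measure)
    have p: "boundary_product (indicator A) (\<lambda>_. 1) = p" "boundary_product (\<lambda>_. 1) (indicator A) = p"
      "boundary_product (indicator A) (indicator A) = p"
      by (simp_all add: p_def sum_boundary_measure boundary_product_def indicator_def if_distrib
          cong: if_cong)
    have "boundary_product ?F (\<lambda>_. 1) = p - c * q"
      unfolding boundary_product_add_left boundary_product_scale_left p one by simp
    also have "\<dots> = 0" using pq by (simp add: c_def)
    finally have "\<sigma> * boundary_product ?F ?F \<le> energy w ?F ?F" by (rule \<sigma>(2))
    also have "energy w ?F ?F = cut_weight w A (- A)"
      unfolding cut_weight_eq_energy by (simp add: energy_def)
    finally have "\<sigma> * boundary_product ?F ?F \<le> cut_weight w A (- A)" .
    moreover have "boundary_product ?F ?F = p - c * p"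
      unfolding boundary_product_add_left boundary_product_scale_left
        boundary_product_add_right boundary_product_scale_right p one
      using pq by (simp add: c_def field_simps)
    moreover have "\<sigma> * (p / 2) \<le> \<sigma> * (p - c * p)"
    proof (rule mult_left_mono)
      have "c \<le> 1 / 2" using pq by (simp add: c_def field_simps)
      then have "c * p \<le> 1 / 2 * p" using pq by (intro mult_right_mono) auto
      then show "p / 2 \<le> p - c * p" by simp
    qed (use \<sigma>(1) in \<open>simp add: positive_eigenvalues_def\<close>)
    ultimately have "\<sigma> * (p / 2) \<le> cut_weight w A (- A)" by simp
    then show "\<sigma> / 2 \<le> cut_weight w A (- A) / sum boundary_measure A"
      using pq by (simp add: p_def[symmetric] field_simps)
  qed
  moreover have "Min positive_eigenvalues \<le> \<sigma>" using \<sigma>(1) finite_positive_eigenvalues by (rule Min_le[rotated])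
  ultimately show ?thesis by (simp add: steklov_sigma_2_eq)
qed

lemma vertex_degree_pos: "vertex_degree w x > 0"
proof -
  obtain y where "y \<noteq> x"
    using card_vertices by (metis card_le_Suc0_iff_eq finite iso_tuple_UNIV_I not_less_eq_eq numeral_2_eq_2)
  moreover have "(x, y) \<in> {(u, v). w u v > 0}\<^sup>*"
    using connected by (auto simp: graph_connected_def)
  ultimately obtain z where "w x z > 0"
    by (auto elim: converse_rtranclE)
  then show ?thesis
    unfolding vertex_degree_eq using weight_nonneg by (intro sum_pos2[of _ z]) auto
qed

text \<open>The heart of Cheeger's inequality, for a mode that is positive somewhere on \<open>B\<close> and positive on at
  most half of it.\<close>
lemma mode_lower_bound:
  assumes mode: "steklov_mode \<sigma> F" and x0: "x0 \<in> B" "F x0 > 0"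
    and half: "sum boundary_measure {x. F x > 0} \<le> sum boundary_measure UNIV / 2"
  shows "\<sigma> \<ge> 1 / 2 * cheeger w boundary_measure boundary_measure
    * cheeger w (vertex_degree w) boundary_measure"
proof -
  define g where "g x = max (F x) 0" for x
  define h1 where "h1 = cheeger w boundary_measure boundary_measure"
  define h2 where "h2 = cheeger w (vertex_degree w) boundary_measure"
  define C where "C = total_variation w (\<lambda>x. (g x)\<^sup>2)"
  define M where "M = boundary_product g g"
  define D where "D = (\<Sum>x\<in>UNIV. vertex_degree w x * (g x)\<^sup>2)"
  have gx0: "g x0 > 0" using x0 by (simp add: g_def)
  have M: "M > 0" unfolding M_def boundary_product_pos_iff using x0(1) gx0 by (intro bexI[of _ x0]) simp_all
  have D: "D > 0"
    unfolding D_def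
  proof (rule sum_pos2[of _ x0])
    show "vertex_degree w x0 * (g x0)\<^sup>2 > 0"
      by (intro mult_pos_pos vertex_degree_pos zero_less_power gx0)
  qed (simp_all add: vertex_degree_pos less_imp_le)
  have level: "k * sum m {x. (g x)\<^sup>2 > t} \<le> cut_weight w {x. (g x)\<^sup>2 > t} (- {x. (g x)\<^sup>2 > t})"
    if "k = cheeger w m boundary_measure" "\<And>x. m x \<ge> 0" "t \<ge> 0" for k m t
    unfolding that(1)
  proof (rule cheeger_mult_le_cut[OF that(2)])
    have "{x. (g x)\<^sup>2 > t} \<subseteq> {x. F x > 0}"
      using that(3) by (auto simp: g_def max_def split: if_splits)
    then have "sum boundary_measure {x. (g x)\<^sup>2 > t} \<le> sum boundary_measure {x. F x > 0}"
      using boundary_measure_nonneg by (intro sum_mono2) auto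
    then show "sum boundary_measure {x. (g x)\<^sup>2 > t} \<le> sum boundary_measure UNIV / 2"
      using half by linarith
  qed
  have "h1 * (\<Sum>x\<in>UNIV. boundary_measure x * (g x)\<^sup>2) \<le> C"
    unfolding C_def using level[OF h1_def boundary_measure_nonneg] by (intro layer_cake_bound) auto
  then have C1: "h1 * M \<le> C"
    unfolding sum_restrict_measure by (simp add: M_def boundary_product_def power2_eq_square mult_ac)
  have C2: "h2 * D \<le> C"
    unfolding C_def D_def using level[OF h2_def] vertex_degree_pos
    by (intro layer_cake_bound) (auto simp: less_imp_le)
  \<comment> \<open>The set where \<open>F > 0\<close> is admissible for both Cheeger constants.\<close>
  have h_nonneg: "cheeger w m boundary_measure \<ge> 0" if "\<And>x. m x \<ge> 0" "m x0 > 0" for m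
  proof (rule cheeger_greatest[OF _ half])
    show "sum m {x. 0 < F x} > 0" using that x0 by (intro sum_pos2[of _ x0]) auto
  qed (auto intro: divide_nonneg_pos cut_weight_nonneg)
  have h1: "h1 \<ge> 0"
    unfolding h1_def using x0 measure_pos
    by (intro h_nonneg boundary_measure_nonneg) (simp add: restrict_measure_def)
  have h2: "h2 \<ge> 0"
    unfolding h2_def using vertex_degree_pos by (intro h_nonneg) (auto simp: less_imp_le)
  have "(h1 * M) * (h2 * D) \<le> C * C"
    using C1 C2 h1 h2 M D by (intro mult_mono) (auto intro: order_trans[OF _ C1])
  also have "\<dots> \<le> 2 * energy w g g * D"
    using total_variation_square_bound[of g] by (simp add: C_def D_def power2_eq_square)
  finally have "(h1 * h2 * M) * D \<le> (2 * energy w g g) * D" by (simp add: mult_ac)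
  then have "h1 * h2 * M \<le> 2 * energy w g g" using D by simp
  \<comment> \<open>Truncation at zero is monotone and contracting.\<close>
  also have "energy w g g \<le> energy w F g"
    unfolding energy_def
  proof (intro divide_right_mono sum_mono)
    fix x y
    have "(g x - g y) * (g x - g y) \<le> (F x - F y) * (g x - g y)"
      by (auto simp: g_def max_def algebra_simps mult_nonpos_nonneg mult_nonneg_nonpos)
    then show "w x y * (g x - g y) * (g x - g y) \<le> w x y * (F x - F y) * (g x - g y)"
      unfolding mult.assoc using weight_nonneg by (rule mult_left_mono)
  qed simp
  also have "energy w F g = \<sigma> * boundary_product F g" by (rule energy_mode[OF mode])
  also have "boundary_product F g = M"
    unfolding M_def boundary_product_def by (intro sum.cong) (auto simp: g_def max_def)
  finally have "(h1 * h2) * M \<le> (2 * \<sigma>) * M" by simp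
  then have "h1 * h2 \<le> 2 * \<sigma>" using M by simp
  then show ?thesis by (simp add: h1_def h2_def)
qed

lemma balanced_positive_somewhere:
  assumes "boundary_product F (\<lambda>_. 1) = 0" "x \<in> B" "F x \<noteq> 0"
  shows "\<exists>y\<in>B. F y > 0"
proof (rule ccontr)
  assume neg: "\<not> ?thesis"
  have "(\<Sum>x\<in>B. - (\<mu> x * F x)) > 0"
  proof (rule sum_pos2[OF _ assms(2)])
    show "0 < - (\<mu> x * F x)"
      using neg assms measure_pos[of x] by (metis less_linear mult_pos_neg neg_0_less_iff_less)
    show "0 \<le> - (\<mu> i * F i)" if "i \<in> B" for i
      using neg that measure_pos[of i] by (auto simp: mult_le_0_iff not_less less_imp_le)
  qed simp
  then show False using assms(1) by (simp add: boundary_product_def sum_negf)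
qed

lemma steklov_lower_bound:
  "steklov_sigma w \<mu> B 2 \<ge> 1 / 2 * cheeger w boundary_measure boundary_measure
    * cheeger w (vertex_degree w) boundary_measure"
proof -
  define \<sigma> where "\<sigma> = Min positive_eigenvalues"
  have "positive_eigenvalues \<noteq> {}" using rayleigh_minimizer by blast
  then have "\<sigma> \<in> positive_eigenvalues" unfolding \<sigma>_def using finite_positive_eigenvalues by (intro Min_in)
  then obtain F x where F: "\<sigma> > 0" "steklov_mode \<sigma> F" "x \<in> B" "F x \<noteq> 0"
    by (auto simp: positive_eigenvalues_def)
  have mode': "steklov_mode \<sigma> (\<lambda>x. - F x)"
  proof -
    have "outflow w (\<lambda>x. - F x) x = - outflow w F x" for x
      by (simp add: outflow_def sum_negf[symmetric] algebra_simps)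
    then show ?thesis using F(2) by (simp add: steklov_mode_def)
  qed
  have "sum boundary_measure {x. F x > 0} + sum boundary_measure {x. - F x > 0}
    = sum boundary_measure ({x. F x > 0} \<union> {x. - F x > 0})"
    by (rule sum.union_disjoint[symmetric]) auto
  also have "\<dots> \<le> sum boundary_measure UNIV"
    using boundary_measure_nonneg by (intro sum_mono2) auto
  \<comment> \<open>Two disjoint sets cannot both carry more than half of the boundary measure.\<close>
  finally consider "sum boundary_measure {x. F x > 0} \<le> sum boundary_measure UNIV / 2"
    | "sum boundary_measure {x. - F x > 0} \<le> sum boundary_measure UNIV / 2"
    by linarith
  then show ?thesis
    unfolding steklov_sigma_2_eq \<sigma>_def[symmetric]
  proof cases
    case 1
    obtain y where "y \<in> B" "F y > 0"
      using balanced_positive_somewhere[OF mode_balanced[OF F(2,1)] F(3,4)] by blast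
    then show "\<sigma> \<ge> 1 / 2 * cheeger w boundary_measure boundary_measure
        * cheeger w (vertex_degree w) boundary_measure"
      using 1 by (rule mode_lower_bound[OF F(2)])
  next
    case 2
    obtain y where "y \<in> B" "- F y > 0"
      using balanced_positive_somewhere[OF mode_balanced[OF mode' F(1)] F(3)] F(4) by auto
    then show "\<sigma> \<ge> 1 / 2 * cheeger w boundary_measure boundary_measure
        * cheeger w (vertex_degree w) boundary_measure"
      using 2 by (rule mode_lower_bound[OF mode'])
  qed
qed

end

theorem corollary1p4:
  fixes w :: "'v::finite \<Rightarrow> 'v \<Rightarrow> real" and \<mu> :: "'v \<Rightarrow> real" and B :: "'v set"
  assumes "weighted_graph w \<mu>"
    and "graph_connected w"
    and "card B \<ge> 2"
  shows "2 * cheeger w (restrict_measure B \<mu>) (restrict_measure B \<mu>) \<ge> steklov_sigma w \<mu> B 2 \<and>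
         steklov_sigma w \<mu> B 2 \<ge>
           1 / 2 * cheeger w (restrict_measure B \<mu>) (restrict_measure B \<mu>)
                 * cheeger w (vertex_degree w) (restrict_measure B \<mu>)"
proof -
  interpret steklov_problem w \<mu> B
    using assms by (simp add: steklov_problem_def steklov_problem_axioms_def)
  show ?thesis using steklov_upper_bound steklov_lower_bound by blast
qed

end
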